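(* Consider the lossy polling system with $m$ stations and the schedulers FoPS$(\alpha)$ described in the context, and assume $\rho_B<w$. For $\alpha>0$ let $\bar{\mathbf u}(\alpha)=(\bar u_1(\alpha),\dots,\bar u_m(\alpha))$ be a solution of the fixed point equation $$\bar u_i=E\big[\hat U_i(\boldsymbol\beta,\mathbf Y)\big]\quad\text{for all } i\in\{1,\dots,m\},$$ where the expectation is under a stationary distribution of the Markov chain $\mathbb Y(\bar{\mathbf u})$ and $\boldsymbol\beta=\boldsymbol\beta(\mathbf Y)$ is the decision rule of that chain. Let $$\mathbb M(\alpha)=\max_{i,j}\frac{\tilde{\bar u}_i(\alpha)}{\tilde{\bar u}_j(\alpha)}-1,\qquad \tilde{\bar u}_i=\max\{\delta,\bar u_i\},$$ be the measure of fairness. Then there exists a constant $B$ with $1\le B<\infty$ such that $\mathbb M(\alpha)\le B^{1/\alpha}-1$ for every $\alpha>0$.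
   Context: **Polling system.** There are $m$ stations and one server. Customers arrive at station $i$ according to independent Poisson processes of rate $\lambda_i>0$ and join queue $Q_i$, which has finite buffer length $b_i$ (an integer $\ge1$); an arrival finding $b_i$ customers in $Q_i$ is lost. Service times are i.i.d. with mean $1/\mu_s$, with the same distribution at all stations. On arriving at (or staying in) station $i$ the server serves exactly one customer if $Q_i$ is non-empty. If $Q_i$ is empty, it waits for a random time having the service-time distribution, serving nobody during this time. Then it makes a new decision: stay, or travel to another station. These instants are the decision epochs $k=1,2,\dots$. At each decision epoch the travel condition from $i$ to $j\ne i$ is good with probability $p_{ij}\in(0,1)$ and bad otherwise, drawn afresh and independently. Given a good (respectively bad) condition, the travel time has a known distribution, the same for all pairs of stations, with mean $\mu_g$ (respectively $\mu_b$), where $\mu_g<\mu_b$. $T_{s,j}$ denotes the travel time from $s$ to $j$ (with $T_{s,s}=0$), $J$ a service/waiting time, and $\mathcal N_i(T)$ the number of Poisson arrivals at $Q_i$ during a time $T$. **State.** $S_{k-1}\in\{1,\dots,m\}$ is the server location at the beginning of decision epoch $k$, and $S_k$ is the station chosen at epoch $k$. $\mathbf N_k=(N_{1,k},\dots,N_{m,k})$ are the numbers of waiting customers. $\mathbf C_k=(C_{1,k},\dots,C_{m,k})$, where $C_{i,k}\in\{g,b\}$ is the travel condition from $S_{k-1}$ to $i\ne S_{k-1}$, and $C_{i,k}=0$ if $i=S_{k-1}$. **Anticipated utilities.** Let $w>0$ be the reward per served customer. For $\mathbf y=(s,\mathbf n,\mathbf c)$ (server location, queue lengths, travel conditions) define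 $$\hat{\mathbb I}_i(\mathbf y)=w\Big(\mathbf 1\{n_i>0\}+\mathbf 1\{n_i=0,\,s\ne i\}\,P(\mathcal N_i(T_{s,i})>0\mid c_i)\Big),\qquad \hat l_i(j,\mathbf y)=E\big[(\mathcal N_i(T_{s,j}+J)+n_i-b_i)^+\mid c_j,n_i\big],$$ and, for a probability vector $\boldsymbol\beta=(\beta_1,\dots,\beta_m)$ ($\beta_j$ being the probability that the server next goes to station $j$), $$\hat U_i(\boldsymbol\beta,\mathbf y)=\beta_i\,\hat{\mathbb I}_i(\mathbf y)-\sum_j\beta_j\,\hat l_i(j,\mathbf y).$$ **Decision rule of FoPS$(\alpha)$ and the chain $\mathbb Y(\mathbf u)$.** Fix a small $\delta>0$. For a vector $\mathbf u=(u_1,\dots,u_m)$ put $\tilde u_i=\max\{\delta,u_i\}$ and $$O_i(\mathbf y,\mathbf u)=\frac{\hat{\mathbb I}_i(\mathbf y)}{\tilde u_i^\alpha}-\sum_j\frac{\hat l_j(i,\mathbf y)}{\tilde u_j^\alpha},\qquad \beta_q(\mathbf y)=\frac{\mathbf 1\{q\in\arg\max_iO_i(\mathbf y,\mathbf u)\}}{|\arg\max_iO_i(\mathbf y,\mathbf u)|}.$$ $\mathbb Y(\mathbf u)=\{(S_{k-1},\mathbf N_k,\mathbf C_k)\}_k$ is the finite-state (possibly reducible) Markov chain in which the decision at every epoch is made by the rule $\boldsymbol\beta(\cdot)$ with the fixed vector $\mathbf u$, i.e. $P(S_k=j\mid \mathbf Y_k)=\beta_j(\mathbf Y_k)$. **Load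 quantity.** $\rho_B:=\max_{i,q}\sum_j\lambda_j\,E[T_{i,q}+J\mid c_q=b]$, where $c_q=b$ means that the travel condition from $i$ to $q$ is bad; the assumption $\rho_B<w$ says that the maximum possible expected losses are less than the maximum possible gain. *)

theory Defs
  imports "HOL-Probability.Probability"
begin

text \<open>
  Stations are the elements of a finite type \<open>'st\<close>, so the number of stations is \<open>CARD('st)\<close>.
  The travel condition from the server location to itself is \<open>Here\<close> (written $0$ in the
  literature).
\<close>

datatype cond = Good | Bad | Here

text \<open>A state is (server location, queue lengths, travel conditions).\<close>

type_synonym 'st state = "'st \<times> ('st \<Rightarrow> nat) \<times> ('st \<Rightarrow> cond)"

record 'st polling =
  arr_rate :: "'st \<Rightarrow> real"
  buffer   :: "'st \<Rightarrow> nat"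
  p_good   :: "'st \<Rightarrow> 'st \<Rightarrow> real"
  service  :: "real measure"
  travel_g :: "real measure"
  travel_b :: "real measure"
  mu_s     :: real
  mu_g     :: real
  mu_b     :: real
  reward   :: real

definition duration_dist :: "real measure \<Rightarrow> real \<Rightarrow> bool" where
  "duration_dist D \<mu> \<longleftrightarrow>
     prob_space D \<and> sets D = sets borel \<and> (AE t in D. 0 \<le> t) \<and>
     integrable D (\<lambda>t. t) \<and> (\<integral>t. t \<partial>D) = \<mu>"

definition polling_system :: "'st::finite polling \<Rightarrow> bool" where
  "polling_system P \<longleftrightarrow>
     (\<forall>i. 0 < arr_rate P i) \<and> (\<forall>i. 1 \<le> buffer P i) \<and>
     (\<forall>i j. i \<noteq> j \<longrightarrow> 0 < p_good P i j \<and> p_good P i j < 1) \<and>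
     0 < mu_s P \<and> duration_dist (service P) (1 / mu_s P) \<and>
     duration_dist (travel_g P) (mu_g P) \<and> duration_dist (travel_b P) (mu_b P) \<and>
     0 < mu_g P \<and> mu_g P < mu_b P \<and> 0 < reward P"

definition travel :: "'st polling \<Rightarrow> 'st \<Rightarrow> 'st \<Rightarrow> cond \<Rightarrow> real measure" where
  "travel P s j c =
     (if j = s then return borel 0 else if c = Good then travel_g P else travel_b P)"

text \<open>Joint law of \<open>(T\<^bsub>s,j\<^esub>, J)\<close>, travel and service time being independent.\<close>

definition travel_service ::
    "'st polling \<Rightarrow> 'st \<Rightarrow> 'st \<Rightarrow> cond \<Rightarrow> (real \<times> real) measure" where
  "travel_service P s j c = travel P s j c \<Otimes>\<^sub>M service P"

text \<open>
  Number of arrivals at station \<open>i\<close> during a time interval of length \<open>t\<close>. The library's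
  \<open>poisson_pmf\<close> is only specified for positive parameters, hence the case distinction.
\<close>

definition arrivals :: "'st polling \<Rightarrow> 'st \<Rightarrow> real \<Rightarrow> nat pmf" where
  "arrivals P i t = (if 0 < t then poisson_pmf (arr_rate P i * t) else return_pmf 0)"


subsection \<open>Anticipated utilities and the decision rule\<close>

definition I_hat :: "'st polling \<Rightarrow> 'st \<Rightarrow> 'st state \<Rightarrow> real" where
  "I_hat P i y = (case y of (s, n, c) \<Rightarrow>
     reward P * (of_bool (0 < n i) + of_bool (n i = 0 \<and> s \<noteq> i) *
       (\<integral>t. measure_pmf.prob (arrivals P i t) {k. 0 < k} \<partial>travel P s i (c i))))"

definition l_hat :: "'st polling \<Rightarrow> 'st \<Rightarrow> 'st \<Rightarrow> 'st state \<Rightarrow> real" where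
  "l_hat P i j y = (case y of (s, n, c) \<Rightarrow>
     (\<integral>(t, x). measure_pmf.expectation (arrivals P i (t + x))
        (\<lambda>k. max 0 (real k + real (n i) - real (buffer P i))) \<partial>travel_service P s j (c j)))"

definition U_hat :: "'st::finite polling \<Rightarrow> 'st \<Rightarrow> ('st \<Rightarrow> real) \<Rightarrow> 'st state \<Rightarrow> real" where
  "U_hat P i \<beta> y = \<beta> i * I_hat P i y - (\<Sum>j\<in>UNIV. \<beta> j * l_hat P i j y)"

definition trunc :: "real \<Rightarrow> ('st \<Rightarrow> real) \<Rightarrow> 'st \<Rightarrow> real" where
  "trunc \<delta> u i = max \<delta> (u i)"

definition objective ::
    "'st::finite polling \<Rightarrow> real \<Rightarrow> real \<Rightarrow> ('st \<Rightarrow> real) \<Rightarrow> 'st state \<Rightarrow> 'st \<Rightarrow> real" where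
  "objective P \<delta> \<alpha> u y i =
     I_hat P i y / trunc \<delta> u i powr \<alpha> - (\<Sum>j\<in>UNIV. l_hat P j i y / trunc \<delta> u j powr \<alpha>)"

definition best_stations ::
    "'st::finite polling \<Rightarrow> real \<Rightarrow> real \<Rightarrow> ('st \<Rightarrow> real) \<Rightarrow> 'st state \<Rightarrow> 'st set" where
  "best_stations P \<delta> \<alpha> u y = {q. \<forall>i. objective P \<delta> \<alpha> u y i \<le> objective P \<delta> \<alpha> u y q}"

definition decision ::
    "'st::finite polling \<Rightarrow> real \<Rightarrow> real \<Rightarrow> ('st \<Rightarrow> real) \<Rightarrow> 'st state \<Rightarrow> 'st \<Rightarrow> real" where
  "decision P \<delta> \<alpha> u y q =
     of_bool (q \<in> best_stations P \<delta> \<alpha> u y) / real (card (best_stations P \<delta> \<alpha> u y))"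


subsection \<open>The Markov chain for a fixed vector \<open>u\<close>\<close>

definition states :: "'st polling \<Rightarrow> 'st state set" where
  "states P = {(s, n, c). (\<forall>i. n i \<le> buffer P i) \<and> (\<forall>i. c i = Here \<longleftrightarrow> i = s)}"

text \<open>
  Queue lengths at the next decision epoch when the server goes to station \<open>j\<close> and there are
  \<open>a i\<close> arrivals at station \<open>i\<close> during the travel time and \<open>d i\<close> during the subsequent
  service or waiting time. A customer occupies its buffer place until its service is completed;
  this makes \<open>I_hat\<close> and \<open>l_hat\<close> the exact conditional means of the reward and of the number
  of losses in one epoch.
\<close>

definition next_queues ::
    "'st polling \<Rightarrow> 'st \<Rightarrow> ('st \<Rightarrow> nat) \<Rightarrow> ('st \<Rightarrow> nat \<times> nat) \<Rightarrow> 'st \<Rightarrow> nat" where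
  "next_queues P j n ad i =
     (let (a, d) = ad i; q = min (buffer P i) (n i + a)
      in min (buffer P i) (q + d) - (if i = j \<and> 0 < q then 1 else 0))"

definition next_conds :: "'st::finite polling \<Rightarrow> 'st \<Rightarrow> ('st \<Rightarrow> cond) pmf" where
  "next_conds P j = Pi_pmf UNIV Here (\<lambda>i. if i = j then return_pmf Here
     else map_pmf (\<lambda>g. if g then Good else Bad) (bernoulli_pmf (p_good P j i)))"

text \<open>
  Next state, given the decision \<open>j\<close>, the travel time \<open>t\<close> and the service or waiting time
  \<open>x\<close>. The numbers of arrivals in the two consecutive periods are independent, and so are the
  arrivals at different stations.
\<close>

definition next_state ::
    "'st::finite polling \<Rightarrow> 'st state \<Rightarrow> 'st \<Rightarrow> real \<Rightarrow> real \<Rightarrow> 'st state pmf" where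
  "next_state P y j t x = (case y of (s, n, c) \<Rightarrow>
     do {
       ad \<leftarrow> Pi_pmf UNIV (0, 0) (\<lambda>i. pair_pmf (arrivals P i t) (arrivals P i x));
       c' \<leftarrow> next_conds P j;
       return_pmf (j, next_queues P j n ad, c')
     })"

definition transition ::
    "'st::finite polling \<Rightarrow> real \<Rightarrow> real \<Rightarrow> ('st \<Rightarrow> real) \<Rightarrow> 'st state \<Rightarrow> 'st state \<Rightarrow> real" where
  "transition P \<delta> \<alpha> u y y' = (case y of (s, n, c) \<Rightarrow>
     \<Sum>j\<in>UNIV. decision P \<delta> \<alpha> u y j *
       (\<integral>(t, x). pmf (next_state P y j t x) y' \<partial>travel_service P s j (c j)))"

definition stationary ::
    "'st::finite polling \<Rightarrow> real \<Rightarrow> real \<Rightarrow> ('st \<Rightarrow> real) \<Rightarrow> 'st state pmf \<Rightarrow> bool" where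
  "stationary P \<delta> \<alpha> u \<pi> \<longleftrightarrow>
     set_pmf \<pi> \<subseteq> states P \<and>
     (\<forall>y'\<in>states P. pmf \<pi> y' = (\<Sum>y\<in>states P. pmf \<pi> y * transition P \<delta> \<alpha> u y y'))"

definition fixed_point :: "'st::finite polling \<Rightarrow> real \<Rightarrow> real \<Rightarrow> ('st \<Rightarrow> real) \<Rightarrow> bool" where
  "fixed_point P \<delta> \<alpha> u \<longleftrightarrow>
     (\<exists>\<pi>. stationary P \<delta> \<alpha> u \<pi> \<and>
       (\<forall>i. u i = measure_pmf.expectation \<pi> (\<lambda>y. U_hat P i (decision P \<delta> \<alpha> u y) y)))"


subsection \<open>Load and fairness\<close>

definition rho_B :: "'st::finite polling \<Rightarrow> real" where
  "rho_B P = Max (range (\<lambda>(i, q).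
     \<Sum>j\<in>UNIV. arr_rate P j * (\<integral>(t, x). t + x \<partial>travel_service P i q Bad)))"

definition fairness :: "real \<Rightarrow> ('st::finite \<Rightarrow> real) \<Rightarrow> real" where
  "fairness \<delta> u = Max (range (\<lambda>(i, j). trunc \<delta> u i / trunc \<delta> u j)) - 1"

end

theory Submission
  imports Defs
begin

text \<open>
Write $W_j = \tilde u_j^\alpha$, let $a$ be a station with the largest and $k$ one with the
smallest truncated utility, and suppose that the ratio $W_a / W_k$ is large. Everything rests on
the observation that the rule then has hardly any reason to send the server to $a$, because
whatever is gained at $a$ is discounted by $W_a$.

If the server is at $s \neq a$, it can stay at $s$. Staying has a non-negative reward, and
compared with going to $a$ it avoids a travel time of positive mean. The expected number of
losses at each station is strictly increasing in the length of an epoch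
(\<open>l_hat_stay_less\<close>), and there are only finitely many states, so every station
loses at least some constant $g > 0$ less when the server stays (\<open>uniform_loss_gap\<close>).
At station $k$ alone this is worth $g / W_k$, whereas $a$ offers at most $w / W_a$. Hence
choosing $a$ forces $W_a / W_k \le w / g$ (\<open>chosen_away_ratio\<close>).

If $Q_k$ is non-empty, then going to $k$ yields at least $(w - \rho_B) / W_k$, because
$1 / W_k$ is the largest weight and the total expected loss is at most $\rho_B$. Hence choosing
$a$ forces $W_a / W_k \le w / (w - \rho_B)$ (\<open>chosen_queue_ratio\<close>). This is where
$\rho_B < w$ enters.

So, when $W_a / W_k$ exceeds both bounds, $a$ can be chosen only by a server that is already
there and finds $Q_k$ empty. Such a server eventually leaves $a$ for ever: in each epoch spent
at $a$ a customer joins $Q_k$ with positive probability, and once away from $a$ the server does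
not return.
Therefore a stationary distribution gives no mass to the states with the server at $a$
(\<open>stationary_never_chosen\<close>), station $a$ is never chosen, and its utility is
non-positive, consisting of losses only (\<open>never_chosen_utility_nonpos\<close>). But then
$\tilde u_a = \delta$ is also the smallest truncated utility, so that $W_a = W_k$ after all.

Consequently $W_a / W_k \le B := \max\{1, w / g, w / (w - \rho_B)\}$, which does not depend on
$\alpha$, and taking the power $1 / \alpha$ gives the claim.
\<close>


section \<open>Expected overflow of a Poisson variable\<close>

text \<open>
The closed form of $E[(N - m)^+]$ for a Poisson variable $N$ of mean $x$: since
$(N - m)^+ = N - m + (m - N)^+$, only a finite sum remains. It makes continuity and
differentiability in $x$ immediate.
\<close>

definition poisson_overflow :: "nat \<Rightarrow> real \<Rightarrow> real" where
  "poisson_overflow m x = x - real m + exp (- x) * (\<Sum>k<m. (real m - real k) * (x ^ k / fact k))"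

lemma poisson_overflow_0 [simp]: "poisson_overflow m 0 = 0"
proof -
  have "(\<Sum>k<m. (real m - real k) * (0 ^ k / fact k)) = real m"
  proof (cases m)
    case (Suc l)
    have "(\<Sum>k<m. (real m - real k) * (0 ^ k / fact k)) = (\<Sum>k\<in>{0}. (real m - real k) * (0 ^ k / fact k))"
      by (rule sum.mono_neutral_right) (auto simp: Suc)
    then show ?thesis by simp
  qed simp
  then show ?thesis by (simp add: poisson_overflow_def)
qed

lemma poisson_overflow_Suc:
  "poisson_overflow (Suc m) x = poisson_overflow m x - 1 + exp (- x) * (\<Sum>k<Suc m. x ^ k / fact k)"
proof -
  have "(\<Sum>k<Suc m. (real (Suc m) - real k) * (x ^ k / fact k)) =
        (\<Sum>k<Suc m. (real m - real k) * (x ^ k / fact k)) + (\<Sum>k<Suc m. x ^ k / fact k)"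
    by (simp only: sum.distrib[symmetric]) (rule sum.cong, simp_all add: algebra_simps add_divide_distrib diff_divide_distrib)
  then show ?thesis
    unfolding poisson_overflow_def by (simp add: algebra_simps)
qed

text \<open>
This is $\frac{d}{dx} P(N \le m) = - P(N = m)$; the derivatives of the terms telescope.
\<close>

lemma DERIV_exp_partial_sum:
  "((\<lambda>x::real. exp (- x) * (\<Sum>k<Suc m. x ^ k / fact k)) has_real_derivative
      - (exp (- x) * (x ^ m / fact m))) (at x)"
proof -
  have p: "((\<lambda>x::real. \<Sum>k<Suc m. x ^ k / fact k) has_real_derivative (\<Sum>k<m. x ^ k / fact k)) (at x)"
  proof (induction m)
    case (Suc m)
    have "((\<lambda>x::real. x ^ Suc m / fact (Suc m)) has_real_derivative x ^ m / fact m) (at x)"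
      by (auto intro!: derivative_eq_intros simp: field_simps simp del: power_Suc of_nat_Suc)
    from DERIV_add[OF Suc.IH this] show ?case
      by (subst (2) sum.lessThan_Suc) (simp only: sum.lessThan_Suc)
  qed (auto intro!: derivative_eq_intros)
  show ?thesis
    by (rule DERIV_cong[OF DERIV_mult[OF _ p]], (rule derivative_eq_intros refl)+)
      (simp add: algebra_simps)
qed

text \<open>
The derivative is $P(N \ge m)$, which is positive for $x > 0$.
\<close>

lemma DERIV_poisson_overflow:
  "(poisson_overflow m has_real_derivative 1 - exp (- x) * (\<Sum>k<m. x ^ k / fact k)) (at x)"
proof (induction m)
  case 0
  have "poisson_overflow 0 = (\<lambda>x. x)" by (auto simp: poisson_overflow_def)
  then show ?case by (auto intro!: derivative_eq_intros)
next
  case (Suc m)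
  show ?case
    unfolding poisson_overflow_Suc[abs_def]
    by (rule DERIV_cong[OF DERIV_add[OF DERIV_diff[OF Suc DERIV_const] DERIV_exp_partial_sum]])
      (simp add: algebra_simps)
qed

lemma exp_partial_sum_less:
  assumes "0 < (x::real)" shows "(\<Sum>k<m. x ^ k / fact k) < exp x"
proof -
  have "(\<Sum>k<m. x ^ k / fact k) < (\<Sum>k. x ^ k / fact k)"
    using assms summable_exp[of x]
    by (intro sum_less_suminf) (auto simp: divide_inverse mult.commute)
  also have "\<dots> = exp x" by (simp add: exp_def divide_inverse mult.commute)
  finally show ?thesis .
qed

lemma poisson_overflow_strict_mono:
  assumes "0 \<le> x" "x < y" shows "poisson_overflow m x < poisson_overflow m y"
proof (rule DERIV_pos_imp_increasing_open[OF assms(2)])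
  fix z assume "x < z" "z < y"
  then have "exp (- z) * (\<Sum>k<m. z ^ k / fact k) < exp (- z) * exp z"
    using assms exp_partial_sum_less[of z m] by simp
  also have "\<dots> = 1" by (simp add: exp_add[symmetric])
  finally show "\<exists>d. (poisson_overflow m has_real_derivative d) (at z) \<and> 0 < d"
    using DERIV_poisson_overflow[of m z] by force
next
  show "continuous_on {x..y} (poisson_overflow m)"
    by (meson DERIV_continuous_on DERIV_poisson_overflow has_field_derivative_at_within)
qed

lemma continuous_on_poisson_overflow: "continuous_on A (poisson_overflow m)"
  by (meson DERIV_continuous_on DERIV_poisson_overflow has_field_derivative_at_within)

lemma poisson_overflow_bounds:
  assumes "0 \<le> x" shows "0 \<le> poisson_overflow m x" "poisson_overflow m x \<le> x"
proof -
  show "0 \<le> poisson_overflow m x"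
    using poisson_overflow_strict_mono[of 0 x m] assms by (cases "x = 0") auto
  show "poisson_overflow m x \<le> x"
  proof (induction m)
    case 0
    then show ?case by (simp add: poisson_overflow_def)
  next
    case (Suc m)
    have "exp (- x) * (\<Sum>k<Suc m. x ^ k / fact k) \<le> exp (- x) * exp x"
      using assms exp_partial_sum_less[of x "Suc m"]
      by (cases "x = 0") (auto simp: sum.lessThan_Suc_shift simp del: sum.lessThan_Suc)
    also have "\<dots> = 1" by (simp add: exp_add[symmetric])
    finally show ?case using Suc by (simp only: poisson_overflow_Suc)
  qed
qed

lemma poisson_mean:
  assumes "0 < r"
  shows "integrable (measure_pmf (poisson_pmf r)) real" 
    and "measure_pmf.expectation (poisson_pmf r) real = r"
proof -
  \<comment> \<open>The term for $k = 0$ vanishes, and the one for $k + 1$ is $r$ times the Poisson weight of $k$.\<close>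
  have s: "(\<lambda>k. r ^ k / fact k * exp (- r) * real k) sums r"
  proof -
    have "(\<lambda>k. r * exp (- r) * (r ^ k / fact k)) sums (r * exp (- r) * exp r)"
      using exp_converges[of r] by (intro sums_mult) (simp add: divide_inverse mult.commute)
    also have "r * exp (- r) * exp r = r" by (simp add: mult.assoc exp_add[symmetric])
    also have "(\<lambda>k. r * exp (- r) * (r ^ k / fact k)) =
       (\<lambda>k. r ^ Suc k / fact (Suc k) * exp (- r) * real (Suc k))"
      by (auto simp: field_simps simp del: of_nat_Suc)
    finally show ?thesis
      by (subst (asm) sums_Suc_iff) simp
  qed
  have i: "integrable (count_space UNIV) (\<lambda>k. r ^ k / fact k * exp (- r) * real k)"
    using sums_summable[OF s] assms by (simp add: integrable_count_space_nat_iff abs_mult)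
  show "integrable (measure_pmf (poisson_pmf r)) real"
    using i assms by (simp add: measure_pmf_eq_density integrable_density)
  have "measure_pmf.expectation (poisson_pmf r) real = (\<Sum>k. r ^ k / fact k * exp (- r) * real k)"
    using i assms by (simp add: measure_pmf_eq_density integral_density integral_count_space_nat)
  then show "measure_pmf.expectation (poisson_pmf r) real = r"
    using s by (simp add: sums_iff)
qed

lemma poisson_expected_overflow:
  assumes r: "0 < r"
  shows "measure_pmf.expectation (poisson_pmf r) (\<lambda>k. max 0 (real k - real m)) = poisson_overflow m r"
proof -
  have fin: "integrable (measure_pmf (poisson_pmf r)) (\<lambda>k. max 0 (real m - real k))"
    by (rule measure_pmf.integrable_const_bound[where B = "real m"]) auto
  have "measure_pmf.expectation (poisson_pmf r) (\<lambda>k. max 0 (real m - real k)) =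
      (\<Sum>k<m. max 0 (real m - real k) * pmf (poisson_pmf r) k)"
    by (rule integral_measure_pmf_real) (auto simp: not_le max_def split: if_splits)
  also have "\<dots> = exp (- r) * (\<Sum>k<m. (real m - real k) * (r ^ k / fact k))"
    unfolding sum_distrib_left using r by (intro sum.cong) auto
  finally have f: "measure_pmf.expectation (poisson_pmf r) (\<lambda>k. max 0 (real m - real k)) =
      exp (- r) * (\<Sum>k<m. (real m - real k) * (r ^ k / fact k))" .
  have "measure_pmf.expectation (poisson_pmf r) (\<lambda>k. max 0 (real k - real m)) =
      measure_pmf.expectation (poisson_pmf r) (\<lambda>k. real k - real m + max 0 (real m - real k))"
    by (intro Bochner_Integration.integral_cong) auto
  also have "\<dots> = poisson_overflow m r"
    using fin poisson_mean[OF r] f by (simp add: poisson_overflow_def)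
  finally show ?thesis .
qed


section \<open>Travel and service times\<close>

text \<open>
With a second probability factor, the projections of a product measure preserve measure. Facts
about travel or service times alone thus transfer to the joint law.
\<close>

lemma prob_space_pair_distr:
  assumes "prob_space M" "prob_space N"
  shows "distr (M \<Otimes>\<^sub>M N) M fst = M" "distr (M \<Otimes>\<^sub>M N) N snd = N"
proof -
  interpret M: prob_space M by fact
  interpret N: prob_space N by fact
  interpret pair_sigma_finite M N by unfold_locales
  show "distr (M \<Otimes>\<^sub>M N) M fst = M" by (rule N.distr_pair_fst)
  have "distr (M \<Otimes>\<^sub>M N) N snd = distr (distr (N \<Otimes>\<^sub>M M) (M \<Otimes>\<^sub>M N) (\<lambda>(x, y). (y, x))) N snd"
    by (subst distr_pair_swap[symmetric]) simp
  also have "\<dots> = distr (N \<Otimes>\<^sub>M M) N fst"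
    by (subst distr_distr) (auto simp: comp_def case_prod_beta)
  also have "\<dots> = N" by (rule M.distr_pair_fst)
  finally show "distr (M \<Otimes>\<^sub>M N) N snd = N" .
qed

lemma pair_integral_marginal:
  fixes f :: "'a \<Rightarrow> real" and g :: "'b \<Rightarrow> real"
  assumes "prob_space M" "prob_space N"
  shows "integrable M f \<Longrightarrow> integrable (M \<Otimes>\<^sub>M N) (\<lambda>z. f (fst z))"
    and "integrable N g \<Longrightarrow> integrable (M \<Otimes>\<^sub>M N) (\<lambda>z. g (snd z))"
    and "f \<in> borel_measurable M \<Longrightarrow> (\<integral>z. f (fst z) \<partial>(M \<Otimes>\<^sub>M N)) = (\<integral>x. f x \<partial>M)"
    and "g \<in> borel_measurable N \<Longrightarrow> (\<integral>z. g (snd z) \<partial>(M \<Otimes>\<^sub>M N)) = (\<integral>x. g x \<partial>N)"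
    and "AE x in M. Q x \<Longrightarrow> AE z in M \<Otimes>\<^sub>M N. Q (fst z)"
    and "AE x in N. R x \<Longrightarrow> AE z in M \<Otimes>\<^sub>M N. R (snd z)"
proof -
  note d = prob_space_pair_distr[OF assms]
  show "integrable (M \<Otimes>\<^sub>M N) (\<lambda>z. f (fst z))" if "integrable M f"
    by (rule integrable_distr[OF measurable_fst]) (simp add: d that)
  show "integrable (M \<Otimes>\<^sub>M N) (\<lambda>z. g (snd z))" if "integrable N g"
    by (rule integrable_distr[OF measurable_snd]) (simp add: d that)
  show "(\<integral>z. f (fst z) \<partial>(M \<Otimes>\<^sub>M N)) = (\<integral>x. f x \<partial>M)" if "f \<in> borel_measurable M"
    using integral_distr[OF measurable_fst that, of N] by (simp add: d)
  show "(\<integral>z. g (snd z) \<partial>(M \<Otimes>\<^sub>M N)) = (\<integral>x. g x \<partial>N)" if "g \<in> borel_measurable N"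
    using integral_distr[OF measurable_snd that, of M] by (simp add: d)
  show "AE z in M \<Otimes>\<^sub>M N. Q (fst z)" if "AE x in M. Q x"
    by (rule AE_distrD[OF measurable_fst[of M N]]) (simp only: d that)
  show "AE z in M \<Otimes>\<^sub>M N. R (snd z)" if "AE x in N. R x"
    by (rule AE_distrD[OF measurable_snd[of M N]]) (simp only: d that)
qed

lemma duration_dist_positive:
  assumes "duration_dist D \<mu>" "0 < \<mu>"
  shows "emeasure D {0<..} \<noteq> 0"
proof
  assume z: "emeasure D {0<..} = 0"
  have s: "sets D = sets borel" using assms by (simp add: duration_dist_def)
  have "AE t in D. t \<notin> {0<..}"
    by (rule AE_not_in) (simp add: null_sets_def z s)
  then have "(\<integral>t. t \<partial>D) = (\<integral>t. 0 \<partial>D)"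
    using assms by (intro integral_cong_AE) (auto simp: duration_dist_def)
  then show False using assms by (simp add: duration_dist_def)
qed

lemma duration_dist_travel:
  assumes "polling_system P"
  shows "duration_dist (travel P s j c) (if j = s then 0 else if c = Good then mu_g P else mu_b P)"
proof -
  interpret R: prob_space "return borel (0::real)" by (simp add: prob_space_return)
  have "integrable (return borel (0::real)) (\<lambda>t. t)"
    by (rule R.integrable_const_bound[where B = 0]) (simp_all add: AE_return)
  moreover have "AE t in return borel (0::real). 0 \<le> t" by (subst AE_return) auto
  moreover have "(\<integral>t. t \<partial>return borel (0::real)) = 0" by (rule integral_return) auto
  ultimately have "duration_dist (return borel (0::real)) 0"
    unfolding duration_dist_def using R.prob_space_axioms by (intro conjI) (auto simp only: sets_return)
  then show ?thesis using assms by (simp add: polling_system_def travel_def)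
qed

lemma duration_dist_service: "polling_system P \<Longrightarrow> duration_dist (service P) (1 / mu_s P)"
  by (simp add: polling_system_def)

lemma sets_travel_service:
  assumes "polling_system P"
  shows "sets (travel_service P s j c) = sets (borel \<Otimes>\<^sub>M borel)"
  unfolding travel_service_def
  using duration_dist_travel[OF assms] duration_dist_service[OF assms]
  by (intro sets_pair_measure_cong) (auto simp: duration_dist_def)

lemma prob_space_travel_service:
  assumes "polling_system P"
  shows "prob_space (travel_service P s j c)"
  unfolding travel_service_def
  using duration_dist_travel[OF assms] duration_dist_service[OF assms]
  by (intro prob_space_pair) (auto simp: duration_dist_def)

lemma travel_service_mean:
  assumes P: "polling_system P"
  shows "integrable (travel_service P s j c) (\<lambda>z. fst z + snd z)"
    and "(\<integral>(t, x). t + x \<partial>travel_service P s j c) =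
      (if j = s then 0 else if c = Good then mu_g P else mu_b P) + 1 / mu_s P"
proof -
  note D = duration_dist_travel[OF P, of s j c] duration_dist_service[OF P]
  have pr: "prob_space (travel P s j c)" "prob_space (service P)"
    using D by (auto simp: duration_dist_def)
  note m = pair_integral_marginal[OF pr]
  have i: "integrable (travel_service P s j c) fst" "integrable (travel_service P s j c) snd"
    using D m(1)[of "\<lambda>x. x"] m(2)[of "\<lambda>x. x"] by (auto simp: duration_dist_def travel_service_def)
  then show "integrable (travel_service P s j c) (\<lambda>z. fst z + snd z)" by simp
  have meas: "(\<lambda>x. x) \<in> borel_measurable (travel P s j c)" "(\<lambda>x. x) \<in> borel_measurable (service P)"
    using D by (auto simp: duration_dist_def)
  have "(\<integral>z. fst z + snd z \<partial>travel_service P s j c) =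
     (\<integral>z. fst z \<partial>travel_service P s j c) + (\<integral>z. snd z \<partial>travel_service P s j c)"
    using i by simp
  also have "\<dots> = (if j = s then 0 else if c = Good then mu_g P else mu_b P) + 1 / mu_s P"
    unfolding travel_service_def m(3)[OF meas(1)] m(4)[OF meas(2)]
    using D by (simp add: duration_dist_def)
  finally show "(\<integral>(t, x). t + x \<partial>travel_service P s j c) =
      (if j = s then 0 else if c = Good then mu_g P else mu_b P) + 1 / mu_s P"
    by (simp add: case_prod_beta')
qed

lemma travel_service_nonneg:
  assumes P: "polling_system P"
  shows "AE z in travel_service P s j c. 0 \<le> fst z" "AE z in travel_service P s j c. 0 \<le> snd z"
proof -
  note D = duration_dist_travel[OF P, of s j c] duration_dist_service[OF P]
  have pr: "prob_space (travel P s j c)" "prob_space (service P)"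
    using D by (auto simp: duration_dist_def)
  show "AE z in travel_service P s j c. 0 \<le> fst z" "AE z in travel_service P s j c. 0 \<le> snd z"
    unfolding travel_service_def
    using D by (intro pair_integral_marginal(5,6)[OF pr]; simp add: duration_dist_def)+
qed

lemma travel_zero:
  assumes P: "polling_system P"
  shows "AE z in travel_service P s s c. fst z = 0"
proof -
  have pr: "prob_space (travel P s s c)" "prob_space (service P)"
    using duration_dist_travel[OF P, of s s c] duration_dist_service[OF P]
    by (auto simp: duration_dist_def)
  have "AE x in return borel 0. x = (0::real)" by (subst AE_return) auto
  then have "AE x in travel P s s c. x = 0" by (simp only: travel_def if_True simp_thms)
  then show ?thesis
    unfolding travel_service_def by (rule pair_integral_marginal(5)[OF pr])
qed


section \<open>Anticipated losses and rewards\<close>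

text \<open>
Losses at station \<open>i\<close> during an epoch of length \<open>t\<close> that starts with
\<open>n\<close> customers there; \<open>l_hat\<close> is its mean over the random length.
\<close>

definition expected_losses :: "'st polling \<Rightarrow> 'st \<Rightarrow> nat \<Rightarrow> real \<Rightarrow> real" where
  "expected_losses P i n t = measure_pmf.expectation (arrivals P i t)
        (\<lambda>k. max 0 (real k + real n - real (buffer P i)))"

lemma expected_losses_eq:
  assumes "0 < arr_rate P i" "n \<le> buffer P i"
  shows "expected_losses P i n t = poisson_overflow (buffer P i - n) (arr_rate P i * max 0 t)"
proof (cases "0 < t")
  case True
  have "(\<lambda>k. max 0 (real k + real n - real (buffer P i))) = (\<lambda>k. max 0 (real k - real (buffer P i - n)))"
    using assms(2) by (auto simp: algebra_simps)
  then show ?thesis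
    using True assms poisson_expected_overflow[of "arr_rate P i * t" "buffer P i - n"]
    by (simp add: expected_losses_def arrivals_def)
next
  case False
  then show ?thesis using assms by (simp add: expected_losses_def arrivals_def max_def)
qed

lemma expected_losses_bounds:
  assumes "0 < arr_rate P i" "n \<le> buffer P i"
  shows "0 \<le> expected_losses P i n t" "expected_losses P i n t \<le> arr_rate P i * max 0 t"
  using assms by (auto simp: expected_losses_eq intro!: poisson_overflow_bounds)

lemma expected_losses_strict_mono:
  assumes "0 < arr_rate P i" "n \<le> buffer P i" "0 \<le> t" "t < t'"
  shows "expected_losses P i n t < expected_losses P i n t'"
  using assms by (auto simp: expected_losses_eq intro!: poisson_overflow_strict_mono)

lemma measurable_expected_losses:
  assumes "0 < arr_rate P i" "n \<le> buffer P i"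
  shows "expected_losses P i n \<in> borel_measurable borel"
proof -
  have "poisson_overflow m \<in> borel_measurable borel" for m
    by (intro borel_measurable_continuous_onI continuous_on_poisson_overflow)
  then have "(\<lambda>t. poisson_overflow (buffer P i - n) (arr_rate P i * max 0 t)) \<in> borel_measurable borel"
    by (rule measurable_compose[rotated]) measurable
  moreover have "expected_losses P i n = (\<lambda>t. poisson_overflow (buffer P i - n) (arr_rate P i * max 0 t))"
    using assms by (auto simp: expected_losses_eq)
  ultimately show ?thesis by simp
qed

lemma l_hat_eq:
  "l_hat P i j (s, n, c) =
     (\<integral>z. expected_losses P i (n i) (fst z + snd z) \<partial>travel_service P s j (c j))"
  by (simp add: l_hat_def expected_losses_def case_prod_beta')

lemma integrable_expected_losses:
  assumes P: "polling_system P" and n: "n \<le> buffer P i"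
  shows "integrable (travel_service P s j c) (\<lambda>z. expected_losses P i n (fst z + snd z))"
proof (rule Bochner_Integration.integrable_bound)
  have r: "0 < arr_rate P i" using P by (simp add: polling_system_def)
  show "integrable (travel_service P s j c) (\<lambda>z. arr_rate P i * (fst z + snd z))"
    using travel_service_mean(1)[OF P] by simp
  note [measurable] = measurable_expected_losses[OF r n]
  note [measurable_cong] = sets_travel_service[OF P]
  show "(\<lambda>z. expected_losses P i n (fst z + snd z)) \<in> borel_measurable (travel_service P s j c)"
    by measurable
  show "AE z in travel_service P s j c. norm (expected_losses P i n (fst z + snd z))
      \<le> norm (arr_rate P i * (fst z + snd z))"
    using travel_service_nonneg[OF P]
  proof eventually_elim
    case (elim z)
    then show ?case
      using expected_losses_bounds[OF r n, of "fst z + snd z"] r by (simp add: max_def)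
  qed
qed

lemma l_hat_bounds:
  assumes P: "polling_system P" and y: "(s, n, c) \<in> states P"
  shows "0 \<le> l_hat P i j (s, n, c)"
    and "l_hat P i j (s, n, c) \<le> arr_rate P i * (\<integral>(t, x). t + x \<partial>travel_service P s j Bad)"
proof -
  have r: "0 < arr_rate P i" using P by (simp add: polling_system_def)
  have n: "n i \<le> buffer P i" using y by (simp add: states_def)
  show "0 \<le> l_hat P i j (s, n, c)"
    unfolding l_hat_eq by (intro integral_nonneg_AE) (simp add: expected_losses_bounds[OF r n])
  have "l_hat P i j (s, n, c) \<le> (\<integral>z. arr_rate P i * (fst z + snd z) \<partial>travel_service P s j (c j))"
    unfolding l_hat_eq
  proof (rule integral_mono_AE)
    show "AE z in travel_service P s j (c j).
        expected_losses P i (n i) (fst z + snd z) \<le> arr_rate P i * (fst z + snd z)"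
      using travel_service_nonneg[OF P]
    proof eventually_elim
      case (elim z)
      then show ?case
        using expected_losses_bounds[OF r n, of "fst z + snd z"] r by (simp add: max_def)
    qed
  qed (use travel_service_mean(1)[OF P] integrable_expected_losses[OF P n] in auto)
  also have "\<dots> = arr_rate P i * (\<integral>(t, x). t + x \<partial>travel_service P s j (c j))"
    by (simp add: case_prod_beta')
  also have "\<dots> \<le> arr_rate P i * (\<integral>(t, x). t + x \<partial>travel_service P s j Bad)"
    unfolding travel_service_mean[OF P]
    using P less_imp_le[OF r] by (intro mult_left_mono) (simp_all add: polling_system_def)
  finally show "l_hat P i j (s, n, c) \<le> arr_rate P i * (\<integral>(t, x). t + x \<partial>travel_service P s j Bad)" .
qed

lemma sum_l_hat_le_rho_B:
  assumes P: "polling_system P" and y: "y \<in> states P"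
  shows "(\<Sum>j\<in>UNIV. l_hat P j i y) \<le> rho_B P"
proof -
  obtain s n c where [simp]: "y = (s, n, c)" by (cases y)
  have "(\<Sum>j\<in>UNIV. l_hat P j i y) \<le>
      (\<Sum>j\<in>UNIV. arr_rate P j * (\<integral>(t, x). t + x \<partial>travel_service P s i Bad))"
    using l_hat_bounds(2)[OF P] y by (intro sum_mono) simp
  also have "\<dots> \<le> rho_B P"
    unfolding rho_B_def by (intro Max_ge) (auto intro!: image_eqI[where x = "(s, i)"])
  finally show ?thesis .
qed

text \<open>
Both sides are expectations under the same joint law of travel and service time: staying
amounts to replacing the travel time by $0$. As the loss is strictly increasing in the length of
the epoch, the strictness comes from the event that the travel time is positive, which has
positive probability because the travel time has a positive mean.
\<close>

lemma l_hat_stay_less: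
  assumes P: "polling_system P" and y: "y \<in> states P" and j: "j \<noteq> fst y"
  shows "l_hat P i (fst y) y < l_hat P i j y"
proof -
  obtain s n c where y': "y = (s, n, c)" by (cases y)
  have r: "0 < arr_rate P i" using P by (simp add: polling_system_def)
  have n: "n i \<le> buffer P i" using y by (simp add: states_def y')
  note [measurable] = measurable_expected_losses[OF r n]
  note [measurable_cong] = sets_travel_service[OF P]
  let ?L = "expected_losses P i (n i)"
  let ?M = "travel_service P s j (c j)"
  have pr: "prob_space (travel P a b d)" "prob_space (service P)" for a b d
    using duration_dist_travel[OF P, of a b d] duration_dist_service[OF P] by (auto simp: duration_dist_def)
  have sets_s [measurable_cong]: "sets (service P) = sets borel"
    using duration_dist_service[OF P] by (simp add: duration_dist_def)
  have sets_t [measurable_cong]: "sets (travel P a b d) = sets borel" for a b d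
    using duration_dist_travel[OF P, of a b d] by (simp add: duration_dist_def)
  interpret M: prob_space ?M by (rule prob_space_travel_service[OF P])
  have "l_hat P i s y = (\<integral>z. ?L (snd z) \<partial>travel_service P s s (c s))"
    unfolding y' l_hat_eq
  proof (rule integral_cong_AE)
    show "AE z in travel_service P s s (c s). ?L (fst z + snd z) = ?L (snd z)"
      using travel_zero[OF P] by eventually_elim simp
  qed measurable
  also have "\<dots> = (\<integral>x. ?L x \<partial>service P)"
    unfolding travel_service_def by (rule pair_integral_marginal(4)[OF pr]) measurable
  also have "\<dots> = (\<integral>z. ?L (snd z) \<partial>?M)"
    unfolding travel_service_def by (rule pair_integral_marginal(4)[OF pr, symmetric]) measurable
  finally have stay: "l_hat P i s y = (\<integral>z. ?L (snd z) \<partial>?M)" .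
  have int: "integrable ?M (\<lambda>z. ?L (fst z + snd z))"
    by (rule integrable_expected_losses[OF P n])
  have le: "AE z in ?M. ?L (snd z) \<le> ?L (fst z + snd z)"
    using travel_service_nonneg[OF P]
  proof eventually_elim
    case (elim z)
    then show ?case
      using expected_losses_strict_mono[OF r n, of "snd z" "fst z + snd z"] by (cases "fst z = 0") auto
  qed
  have int0: "integrable ?M (\<lambda>z. ?L (snd z))"
  proof (rule Bochner_Integration.integrable_bound[OF int])
    show "AE z in ?M. norm (?L (snd z)) \<le> norm (?L (fst z + snd z))"
      using le by eventually_elim (simp add: expected_losses_bounds[OF r n])
  qed measurable
  have "emeasure (travel P s j (c j)) {0<..} \<noteq> 0"
    using j P by (intro duration_dist_positive[OF duration_dist_travel[OF P]])
      (auto simp: y' polling_system_def)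
  moreover have "emeasure ?M ({0<..} \<times> UNIV) = emeasure (travel P s j (c j)) {0<..}"
  proof -
    have "emeasure ?M ({0<..} \<times> UNIV) = emeasure (travel P s j (c j)) {0<..} * emeasure (service P) UNIV"
      unfolding travel_service_def using prob_space_imp_sigma_finite[OF pr(2)]
      by (intro sigma_finite_measure.emeasure_pair_measure_Times) (auto simp: sets_s sets_t)
    also have "emeasure (service P) UNIV = 1"
      using prob_space.emeasure_space_1[OF pr(2)] sets_eq_imp_space_eq[OF sets_s] by simp
    finally show ?thesis by simp
  qed
  ultimately have "emeasure ?M ({0<..} \<times> UNIV) \<noteq> 0" by simp
  then have "(\<integral>z. ?L (snd z) \<partial>?M) < (\<integral>z. ?L (fst z + snd z) \<partial>?M)"
  proof (rule M.integral_less_AE[OF int0 int _ _ _ le])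
    show "{0<..} \<times> UNIV \<in> sets ?M" by (simp add: sets_travel_service[OF P])
    show "AE z in ?M. z \<in> {0<..} \<times> UNIV \<longrightarrow> ?L (snd z) \<noteq> ?L (fst z + snd z)"
      using travel_service_nonneg(2)[OF P]
    proof eventually_elim
      case (elim z)
      then show ?case
        using expected_losses_strict_mono[OF r n, of "snd z" "fst z + snd z"] by (cases z) auto
    qed
  qed
  then show ?thesis using stay by (simp add: y' l_hat_eq)
qed

lemma finite_states: "finite (states (P :: 'st::finite polling))"
proof -
  have *: "PiE (UNIV :: 'st set) A = {f. \<forall>i. f i \<in> A i}" for A :: "'st \<Rightarrow> 'b set"
    by (auto simp: PiE_def extensional_def)
  have "finite (PiE (UNIV :: 'st set) (\<lambda>i. {..buffer P i}))"
    "finite (PiE (UNIV :: 'st set) (\<lambda>i. {Good, Bad, Here}))"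
    by (intro finite_PiE; simp)+
  then have "finite ((UNIV :: 'st set) \<times> {n. \<forall>i. n i \<in> {..buffer P i}} \<times> {c :: 'st \<Rightarrow> cond. \<forall>i. c i \<in> {Good, Bad, Here}})"
    unfolding * by (intro finite_cartesian_product) auto
  moreover have "states P \<subseteq> UNIV \<times> {n. \<forall>i. n i \<in> {..buffer P i}} \<times> {c. \<forall>i. c i \<in> {Good, Bad, Here}}"
  proof -
    have "x \<in> {Good, Bad, Here}" for x by (cases x) simp_all
    then show ?thesis unfolding states_def by blast
  qed
  ultimately show ?thesis by (rule finite_subset[rotated])
qed

text \<open>
The gap has to be independent of the utilities and of $\alpha$; the finiteness of the state
space provides this.
\<close>

lemma uniform_loss_gap:
  assumes P: "polling_system (P :: 'st::finite polling)"
  obtains g where "0 < g"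
    "\<And>y k a. y \<in> states P \<Longrightarrow> a \<noteq> fst y \<Longrightarrow> g \<le> l_hat P k a y - l_hat P k (fst y) y"
proof -
  let ?A = "{(y, k :: 'st, a). y \<in> states P \<and> a \<noteq> fst y}"
  let ?G = "(\<lambda>(y, k, a). l_hat P k a y - l_hat P k (fst y) y) ` ?A"
  \<comment> \<open>The index set is empty if there is only one station; the extra element $1$ keeps the minimum defined.\<close>
  have "?A \<subseteq> states P \<times> UNIV" by auto
  moreover have "finite (states P \<times> (UNIV :: ('st \<times> 'st) set))"
    using finite_states[of P] by simp
  ultimately have "finite ?A" by (rule finite_subset)
  then have fin: "finite (insert 1 ?G)" by simp
  show thesis
  proof
    show "0 < Min (insert 1 ?G)"
      using fin by (subst Min_gr_iff) (auto simp: l_hat_stay_less[OF P])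
    show "Min (insert 1 ?G) \<le> l_hat P k a y - l_hat P k (fst y) y"
      if "y \<in> states P" "a \<noteq> fst y" for y k a
      using that by (intro Min_le[OF fin]) force
  qed
qed

lemma I_hat_bounds:
  assumes P: "polling_system P"
  shows "0 \<le> I_hat P i y" "I_hat P i y \<le> reward P"
proof -
  obtain s n c where y': "y = (s, n, c)" by (cases y)
  have w: "0 < reward P" using P by (simp add: polling_system_def)
  interpret prob_space "travel P s i (c i)"
    using duration_dist_travel[OF P] by (simp add: duration_dist_def)
  let ?p = "\<integral>t. measure_pmf.prob (arrivals P i t) {k. 0 < k} \<partial>travel P s i (c i)"
  have "0 \<le> ?p" by (intro integral_nonneg_AE) simp
  moreover have "?p \<le> 1"
  proof (cases "integrable (travel P s i (c i)) (\<lambda>t. measure_pmf.prob (arrivals P i t) {k. 0 < k})")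
    case True
    then have "?p \<le> (\<integral>t. 1 \<partial>travel P s i (c i))" by (intro integral_mono) auto
    then show ?thesis by (simp add: prob_space)
  qed (simp add: not_integrable_integral_eq)
  ultimately show "0 \<le> I_hat P i y" "I_hat P i y \<le> reward P"
    using w unfolding I_hat_def y' by (auto simp: of_bool_def)
qed

lemma I_hat_nonempty: "0 < fst (snd y) i \<Longrightarrow> I_hat P i y = reward P"
  by (cases y) (simp add: I_hat_def)


section \<open>Transition probabilities\<close>

text \<open>
The factor of \<open>transition\<close> that depends neither on the utilities nor on
$\alpha$. All positivity and normalisation arguments concern this factor.
\<close>

definition step_prob :: "'st::finite polling \<Rightarrow> 'st state \<Rightarrow> 'st \<Rightarrow> 'st state \<Rightarrow> real" where
  "step_prob P y j y' =
     (\<integral>z. pmf (next_state P y j (fst z) (snd z)) y' \<partial>travel_service P (fst y) j (snd (snd y) j))"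

lemma transition_eq:
  "transition P \<delta> \<alpha> u y y' = (\<Sum>j\<in>UNIV. decision P \<delta> \<alpha> u y j * step_prob P y j y')"
  by (cases y) (simp add: transition_def step_prob_def case_prod_beta')

lemma measurable_pmf_arrivals: "(\<lambda>t. pmf (arrivals P i t) k) \<in> borel_measurable borel"
  if "0 < arr_rate P i"
proof -
  have "(\<lambda>t. pmf (arrivals P i t) k) =
     (\<lambda>t. if 0 < t then (arr_rate P i * t) ^ k / fact k * exp (- (arr_rate P i * t)) else of_bool (k = 0))"
    using that by (auto simp: arrivals_def fun_eq_iff)
  then show ?thesis by simp
qed

text \<open>
Conditioning on the arrival numbers turns the probability into a countable sum of products of
Poisson probabilities, each of which is measurable in the travel and the service time.
The Bochner integral of a non-measurable function is $0$, so without this fact nothing could be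
concluded about transition probabilities.
\<close>

lemma measurable_pmf_next_state:
  fixes P :: "'st::finite polling"
  assumes P: "polling_system P"
  shows "(\<lambda>z. pmf (next_state P y j (fst z) (snd z)) y') \<in> borel_measurable (borel \<Otimes>\<^sub>M borel)"
proof -
  obtain s n c where y: "y = (s, n, c)" by (cases y)
  have [measurable]: "(\<lambda>t. pmf (arrivals P i t) k) \<in> borel_measurable borel" for i k
    using P by (intro measurable_pmf_arrivals) (simp add: polling_system_def)
  let ?q = "\<lambda>ad z. \<Prod>i\<in>UNIV. pmf (arrivals P i (fst z)) (fst (ad i)) * pmf (arrivals P i (snd z)) (snd (ad i))"
  let ?r = "\<lambda>ad. pmf (next_conds P j \<bind> (\<lambda>c'. return_pmf (j, next_queues P j n ad, c'))) y'"
  have "pmf (next_state P y j (fst z) (snd z)) y' = (\<integral>ad. ?q ad z * ?r ad \<partial>count_space UNIV)" for z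
  proof -
    let ?N = "Pi_pmf UNIV (0, 0) (\<lambda>i. pair_pmf (arrivals P i (fst z)) (arrivals P i (snd z)))"
    have q: "pmf ?N ad = ?q ad z" for ad
    proof -
      have "pmf (pair_pmf M N) p = pmf M (fst p) * pmf N (snd p)" for M N :: "nat pmf" and p
        by (cases p) (simp add: pmf_pair)
      then show ?thesis by (subst pmf_Pi') auto
    qed
    have "pmf (next_state P y j (fst z) (snd z)) y' = (\<integral>ad. ?r ad \<partial>measure_pmf ?N)"
      by (simp add: next_state_def y pmf_bind)
    also have "\<dots> = (\<integral>ad. pmf ?N ad * ?r ad \<partial>count_space UNIV)"
      by (simp add: measure_pmf_eq_density integral_density)
    finally show ?thesis by (simp only: q)
  qed
  moreover have "(\<lambda>z. \<integral>ad. ?q ad z * ?r ad \<partial>count_space UNIV) \<in> borel_measurable (borel \<Otimes>\<^sub>M borel)"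
  proof (rule sigma_finite_measure.borel_measurable_lebesgue_integral)
    have swapped: "(\<lambda>(ad, z). ?q ad z * ?r ad) \<in>
        borel_measurable (count_space UNIV \<Otimes>\<^sub>M (borel \<Otimes>\<^sub>M borel))"
      by (rule measurable_pair_measure_countable1) simp_all
    show "sigma_finite_measure (count_space (UNIV :: ('st \<Rightarrow> nat \<times> nat) set))"
      by (rule sigma_finite_measure_count_space)
    show "(\<lambda>(z, ad). ?q ad z * ?r ad) \<in> borel_measurable ((borel \<Otimes>\<^sub>M borel) \<Otimes>\<^sub>M count_space UNIV)"
      using measurable_pair_swap[OF swapped] by (simp add: case_prod_beta')
  qed
  ultimately show ?thesis by simp
qed

lemma integrable_pmf_next_state:
  assumes P: "polling_system P"
  shows "integrable (travel_service P s j c) (\<lambda>z. pmf (next_state P y j' (fst z) (snd z)) y')"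
proof -
  interpret prob_space "travel_service P s j c" by (rule prob_space_travel_service[OF P])
  show ?thesis
    using measurable_pmf_next_state[OF P]
    by (intro integrable_const_bound[where B = 1])
      (auto simp: pmf_le_1 measurable_cong_sets[OF sets_travel_service[OF P] refl])
qed

lemma step_prob_nonneg: "0 \<le> step_prob P y j y'"
  unfolding step_prob_def by (intro integral_nonneg_AE) simp

lemma step_prob_other_station:
  assumes "fst y' \<noteq> j" shows "step_prob P y j y' = 0"
proof -
  have "pmf (next_state P y j t x) y' = 0" for t x
    using assms by (cases y) (auto simp: next_state_def pmf_eq_0_set_pmf)
  then show ?thesis by (simp add: step_prob_def)
qed

lemma sum_step_prob_le_1:
  assumes P: "polling_system P" and F: "finite F"
  shows "(\<Sum>y'\<in>F. step_prob P y j y') \<le> 1"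
proof -
  let ?M = "travel_service P (fst y) j (snd (snd y) j)"
  interpret prob_space ?M by (rule prob_space_travel_service[OF P])
  note int = integrable_pmf_next_state[OF P, of "fst y" j "snd (snd y) j" y j]
  have "(\<Sum>y'\<in>F. step_prob P y j y') = (\<integral>z. (\<Sum>y'\<in>F. pmf (next_state P y j (fst z) (snd z)) y') \<partial>?M)"
    unfolding step_prob_def by (rule Bochner_Integration.integral_sum[symmetric]) (rule int)
  also have "\<dots> \<le> (\<integral>z. 1 \<partial>?M)"
  proof (rule integral_mono)
    fix z
    have "(\<Sum>y'\<in>F. pmf (next_state P y j (fst z) (snd z)) y') =
        measure_pmf.prob (next_state P y j (fst z) (snd z)) F"
      using F by (rule measure_measure_pmf_finite[symmetric])
    then show "(\<Sum>y'\<in>F. pmf (next_state P y j (fst z) (snd z)) y') \<le> 1" by simp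
  qed (use int in auto)
  finally show ?thesis by (simp add: prob_space)
qed

text \<open>
The witness results from an epoch in which one customer joins $Q_k$, nobody else arrives, and
the next travel conditions are all good. There is no travel time, and the service time is
positive with positive probability, so such an epoch has positive probability.
\<close>

lemma step_prob_stay_with_arrival:
  fixes P :: "'st::finite polling"
  assumes P: "polling_system P" and y: "y \<in> states P" "fst y = a" and k: "k \<noteq> a"
  obtains y' where "y' \<in> states P" "fst y' = a" "0 < fst (snd y') k" "0 < step_prob P y a y'"
proof -
  obtain n c where y': "y = (a, n, c)" using y(2) by (cases y) auto
  have r: "0 < arr_rate P i" "1 \<le> buffer P i" for i using P by (auto simp: polling_system_def)
  define ad :: "'st \<Rightarrow> nat \<times> nat" where "ad = (\<lambda>i. (0, if i = k then 1 else 0))"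
  define c' :: "'st \<Rightarrow> cond" where "c' = (\<lambda>i. if i = a then Here else Good)"
  let ?z = "(a, next_queues P a n ad, c')"
  let ?M = "travel_service P a a (c a)"
  have pos: "0 < pmf (next_state P y a 0 x) ?z" if "0 < x" for x
  proof -
    have "c' \<in> set_pmf (next_conds P a)"
      using P by (auto simp: next_conds_def set_Pi_pmf PiE_dflt_def c'_def polling_system_def)
    moreover have "ad \<in> set_pmf (Pi_pmf UNIV (0, 0) (\<lambda>i. pair_pmf (arrivals P i 0) (arrivals P i x)))"
      using that r by (auto simp: set_Pi_pmf PiE_dflt_def ad_def arrivals_def)
    ultimately have "?z \<in> set_pmf (next_state P y a 0 x)"
      by (auto simp: next_state_def y')
    then show ?thesis by (simp add: pmf_positive)
  qed
  \<comment> \<open>If the integral vanished, the service time would be $0$ almost surely, against its positive mean.\<close>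
  have "step_prob P y a ?z \<noteq> 0"
  proof
    assume "step_prob P y a ?z = 0"
    then have "(\<integral>z. pmf (next_state P y a (fst z) (snd z)) ?z \<partial>?M) = 0"
      by (simp add: step_prob_def y')
    then have "AE z in ?M. pmf (next_state P y a (fst z) (snd z)) ?z = 0"
      using integrable_pmf_next_state[OF P] by (subst (asm) integral_nonneg_eq_0_iff_AE) auto
    moreover note travel_zero[OF P] travel_service_nonneg(2)[OF P]
    ultimately have "AE z in ?M. fst z + snd z = 0"
    proof eventually_elim
      case (elim z)
      then show ?case using pos[of "snd z"] by (cases "snd z = 0") auto
    qed
    then have "(\<integral>z. fst z + snd z \<partial>?M) = (\<integral>z. 0 \<partial>?M)"
      by (intro integral_cong_AE borel_measurable_integrable travel_service_mean(1)[OF P]) auto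
    then show False
      using travel_service_mean(2)[OF P, of a a "c a"] P by (simp add: case_prod_beta' polling_system_def)
  qed
  then have "0 < step_prob P y a ?z"
    using step_prob_nonneg[of P y a ?z] by linarith
  moreover have "?z \<in> states P"
    using y r by (auto simp: states_def next_queues_def ad_def c'_def Let_def intro: le_trans[OF diff_le_self])
  moreover have "0 < fst (snd ?z) k"
    using k r[of k] by (simp add: next_queues_def ad_def)
  ultimately show thesis by (intro that[of ?z]) auto
qed


section \<open>Decisions and their stationary consequences\<close>

lemma decision_bounds: "0 \<le> decision P \<delta> \<alpha> u y q" "decision P \<delta> \<alpha> u y q \<le> 1"
proof -
  have "real (card (best_stations P \<delta> \<alpha> u y)) \<ge> 1" if "q \<in> best_stations P \<delta> \<alpha> u y"
  proof -
    have "card (best_stations P \<delta> \<alpha> u y) \<noteq> 0" using that by auto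
    then show ?thesis by linarith
  qed
  then show "0 \<le> decision P \<delta> \<alpha> u y q" "decision P \<delta> \<alpha> u y q \<le> 1"
    unfolding decision_def by (cases "q \<in> best_stations P \<delta> \<alpha> u y"; simp)+
qed

lemma decision_optimal:
  assumes "decision P \<delta> \<alpha> u y a \<noteq> 0"
  shows "objective P \<delta> \<alpha> u y i \<le> objective P \<delta> \<alpha> u y a"
proof -
  have "a \<in> best_stations P \<delta> \<alpha> u y" using assms unfolding decision_def by (rule contrapos_np) simp
  then show ?thesis unfolding best_stations_def by blast
qed

text \<open>
Compare \<open>a\<close> with staying, whose reward is non-negative. Every station loses less
when the server stays, so the difference of the weighted losses is at least the contribution of
station \<open>k\<close>.
\<close>

lemma chosen_away_ratio:
  assumes P: "polling_system P" and \<delta>: "0 < \<delta>" and y: "y \<in> states P" and a: "fst y \<noteq> a"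
    and chosen: "decision P \<delta> \<alpha> u y a \<noteq> 0"
    and gap: "0 < g" "g \<le> l_hat P k a y - l_hat P k (fst y) y"
  shows "trunc \<delta> u a powr \<alpha> \<le> reward P / g * trunc \<delta> u k powr \<alpha>"
proof -
  let ?s = "fst y"
  define W where "W i = trunc \<delta> u i powr \<alpha>" for i
  have pos: "0 < trunc \<delta> u i" for i using \<delta> unfolding trunc_def by linarith
  have W: "0 < W i" for i using pos[of i] unfolding W_def by (subst powr_gt_zero) linarith
  have "g / W k \<le> (l_hat P k a y - l_hat P k ?s y) / W k"
    using gap(2) less_imp_le[OF W[of k]] by (rule divide_right_mono)
  also have "\<dots> \<le> (\<Sum>j\<in>UNIV. (l_hat P j a y - l_hat P j ?s y) / W j)"
  proof (rule member_le_sum)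
    show "0 \<le> (l_hat P j a y - l_hat P j ?s y) / W j" for j
      using l_hat_stay_less[OF P y a[symmetric], of j] W[of j] by (intro divide_nonneg_pos) linarith+
  qed simp_all
  also have "\<dots> \<le> I_hat P a y / W a - I_hat P ?s y / W ?s"
    using decision_optimal[OF chosen, of ?s]
    by (simp add: objective_def W_def diff_divide_distrib sum_subtractf)
  also have "\<dots> \<le> reward P / W a"
    using divide_right_mono[OF I_hat_bounds(2)[OF P, of a y] less_imp_le[OF W[of a]]]
      divide_nonneg_pos[OF I_hat_bounds(1)[OF P, of ?s y] W[of ?s]] by linarith
  finally show ?thesis
    using W gap(1) unfolding W_def[symmetric] by (simp add: field_simps)
qed

text \<open>
Compare \<open>a\<close> with \<open>k\<close>. The reward $w$ is certain at \<open>k\<close> and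
has the weight $1 / W_k$, writing $W_j = \tilde u_j^\alpha$; no loss has a larger weight, so the
weighted losses amount to at most $\rho_B / W_k$.
\<close>

lemma chosen_queue_ratio:
  assumes P: "polling_system P" and \<delta>: "0 < \<delta>" and y: "y \<in> states P" and \<alpha>: "0 < \<alpha>"
    and \<rho>: "rho_B P < reward P"
    and chosen: "decision P \<delta> \<alpha> u y a \<noteq> 0" and queue: "0 < fst (snd y) k"
    and k: "\<And>j. trunc \<delta> u k \<le> trunc \<delta> u j"
  shows "trunc \<delta> u a powr \<alpha> \<le> reward P / (reward P - rho_B P) * trunc \<delta> u k powr \<alpha>"
proof -
  define W where "W i = trunc \<delta> u i powr \<alpha>" for i
  have pos: "0 < trunc \<delta> u i" for i using \<delta> unfolding trunc_def by linarith
  have W: "0 < W i" for i using pos[of i] unfolding W_def by (subst powr_gt_zero) linarith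
  have Wk: "W k \<le> W j" for j
    unfolding W_def using less_imp_le[OF \<alpha>] less_imp_le[OF pos[of k]] k[of j] by (rule powr_mono2)
  have l: "0 \<le> l_hat P i j y" for i j
    using l_hat_bounds(1)[OF P] y by (cases y) auto
  have "(reward P - rho_B P) / W k \<le> reward P / W k - (\<Sum>j\<in>UNIV. l_hat P j k y / W k)"
    unfolding sum_divide_distrib[symmetric] diff_divide_distrib[symmetric]
    using sum_l_hat_le_rho_B[OF P y, of k] less_imp_le[OF W[of k]] by (intro divide_right_mono) linarith+
  also have "\<dots> \<le> I_hat P k y / W k - (\<Sum>j\<in>UNIV. l_hat P j k y / W j)"
    unfolding I_hat_nonempty[OF queue]
    by (intro diff_left_mono sum_mono divide_left_mono Wk l mult_pos_pos W)
  also have "\<dots> \<le> I_hat P a y / W a - (\<Sum>j\<in>UNIV. l_hat P j a y / W j)"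
    using decision_optimal[OF chosen, of k] by (simp add: objective_def W_def)
  also have "\<dots> \<le> reward P / W a - 0"
    by (intro diff_mono divide_right_mono sum_nonneg divide_nonneg_pos I_hat_bounds[OF P] l W less_imp_le[OF W])
  finally show ?thesis
    using W \<rho> unfolding W_def[symmetric] by (simp add: field_simps)
qed

text \<open>
Let $F$ be the set of states with the server at $a$. By the first hypothesis on the decisions,
$F$ can be entered only from $F$, so stationarity requires that no mass leaves $F$: at every
state of $F$ with positive mass $a$ is chosen with probability $1$. But from such a state a
state of $F$ with $n_k > 0$ is reached with positive probability. It has positive mass too, and
there $a$ is not chosen by the second hypothesis.
\<close>

lemma stationary_never_chosen:
  fixes P :: "'st::finite polling"
  assumes P: "polling_system P" and st: "stationary P \<delta> \<alpha> u \<pi>" and k: "k \<noteq> a"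
    and away: "\<And>y. y \<in> states P \<Longrightarrow> fst y \<noteq> a \<Longrightarrow> decision P \<delta> \<alpha> u y a = 0"
    and queue: "\<And>y. y \<in> states P \<Longrightarrow> 0 < fst (snd y) k \<Longrightarrow> decision P \<delta> \<alpha> u y a = 0"
    and y: "y \<in> set_pmf \<pi>"
  shows "decision P \<delta> \<alpha> u y a = 0"
proof -
  let ?d = "\<lambda>y. decision P \<delta> \<alpha> u y a"
  let ?S = "states P"
  define F where "F = {y\<in>?S. fst y = a}"
  have F: "finite F" using finite_states[of P] by (simp add: F_def)
  have trans: "transition P \<delta> \<alpha> u x y' = ?d x * step_prob P x a y'" if "fst y' = a" for x y'
  proof -
    have "transition P \<delta> \<alpha> u x y' = (\<Sum>j\<in>{a}. decision P \<delta> \<alpha> u x j * step_prob P x j y')"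
      unfolding transition_eq using that by (intro sum.mono_neutral_right) (auto simp: step_prob_other_station)
    then show ?thesis by simp
  qed
  have stat: "pmf \<pi> y' = (\<Sum>x\<in>F. pmf \<pi> x * (?d x * step_prob P x a y'))" if "y' \<in> F" for y'
  proof -
    have "pmf \<pi> y' = (\<Sum>x\<in>?S. pmf \<pi> x * (?d x * step_prob P x a y'))"
      using st that trans[of y'] by (simp add: stationary_def F_def)
    also have "\<dots> = (\<Sum>x\<in>F. pmf \<pi> x * (?d x * step_prob P x a y'))"
      using away by (intro sum.mono_neutral_right) (auto simp: F_def finite_states)
    finally show ?thesis .
  qed
  have "(\<Sum>y'\<in>F. pmf \<pi> y') = (\<Sum>y'\<in>F. \<Sum>x\<in>F. pmf \<pi> x * (?d x * step_prob P x a y'))"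
    using stat by (rule sum.cong[OF refl])
  also have "\<dots> = (\<Sum>x\<in>F. pmf \<pi> x * ?d x * (\<Sum>y'\<in>F. step_prob P x a y'))"
    by (subst sum.swap) (simp add: sum_distrib_left mult.assoc)
  also have "\<dots> \<le> (\<Sum>x\<in>F. pmf \<pi> x * ?d x)"
    by (intro sum_mono mult_left_le sum_step_prob_le_1[OF P F] mult_nonneg_nonneg decision_bounds pmf_nonneg)
  finally have "(\<Sum>x\<in>F. pmf \<pi> x * (1 - ?d x)) \<le> 0"
    by (simp add: algebra_simps sum_subtractf)
  moreover have nn: "0 \<le> pmf \<pi> x * (1 - ?d x)" for x
    by (simp add: decision_bounds)
  ultimately have "(\<Sum>x\<in>F. pmf \<pi> x * (1 - ?d x)) = 0"
    by (intro antisym sum_nonneg) auto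
  then have one: "?d x = 1" if "x \<in> F" "pmf \<pi> x \<noteq> 0" for x
    using that nn F by (auto simp: sum_nonneg_eq_0_iff)
  have "y \<notin> F"
  proof
    assume yF: "y \<in> F"
    then obtain y' where y': "y' \<in> ?S" "fst y' = a" "0 < fst (snd y') k" "0 < step_prob P y a y'"
      using step_prob_stay_with_arrival[OF P _ _ k, of y] unfolding F_def by blast
    have py: "0 < pmf \<pi> y" using y by (rule pmf_positive)
    then have "0 < pmf \<pi> y * (?d y * step_prob P y a y')"
      using one[OF yF] y'(4) by simp
    also have "\<dots> \<le> (\<Sum>x\<in>F. pmf \<pi> x * (?d x * step_prob P x a y'))"
      by (intro member_le_sum[OF yF] F mult_nonneg_nonneg decision_bounds step_prob_nonneg pmf_nonneg)
    also have "\<dots> = pmf \<pi> y'" using y' stat[of y'] by (simp add: F_def)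
    finally have "?d y' = 1" using y' by (intro one) (auto simp: F_def)
    with queue[OF y'(1,3)] show False by simp
  qed
  moreover have "y \<in> ?S" using y st by (auto simp: stationary_def)
  ultimately show ?thesis using away by (simp add: F_def)
qed

lemma never_chosen_utility_nonpos:
  assumes P: "polling_system P" and st: "stationary P \<delta> \<alpha> u \<pi>"
    and "\<And>y. y \<in> set_pmf \<pi> \<Longrightarrow> decision P \<delta> \<alpha> u y a = 0"
  shows "measure_pmf.expectation \<pi> (\<lambda>y. U_hat P a (decision P \<delta> \<alpha> u y) y) \<le> 0"
proof -
  have "0 \<le> measure_pmf.expectation \<pi> (\<lambda>y. - U_hat P a (decision P \<delta> \<alpha> u y) y)"
  proof (intro integral_nonneg_AE, rule AE_pmfI)
    fix y assume y: "y \<in> set_pmf \<pi>"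
    then have "y \<in> states P" using st by (auto simp: stationary_def)
    then have "0 \<le> l_hat P a j y" for j
      using l_hat_bounds(1)[OF P] by (cases y) auto
    then show "0 \<le> - U_hat P a (decision P \<delta> \<alpha> u y) y"
      using assms(3)[OF y] by (auto simp: U_hat_def intro!: sum_nonneg mult_nonneg_nonneg decision_bounds)
  qed
  then show ?thesis by simp
qed


section \<open>The fairness bound\<close>

theorem theorem2:
  fixes P :: "'st::finite polling" and \<delta> :: real
  assumes "polling_system P"
    and "0 < \<delta>"
    and "rho_B P < reward P"
  shows "\<exists>B::real. 1 \<le> B \<and>
    (\<forall>\<alpha>>0. \<forall>u. fixed_point P \<delta> \<alpha> u \<longrightarrow> fairness \<delta> u \<le> B powr (1 / \<alpha>) - 1)"
proof -
  note P = assms(1)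
  obtain g where g: "0 < g"
    "\<And>y k a. y \<in> states P \<Longrightarrow> a \<noteq> fst y \<Longrightarrow> g \<le> l_hat P k a y - l_hat P k (fst y) y"
    using uniform_loss_gap[OF P] by blast
  define B where "B = Max {1, reward P / g, reward P / (reward P - rho_B P)}"
  have B: "1 \<le> B" "reward P / g \<le> B" "reward P / (reward P - rho_B P) \<le> B"
    by (auto simp: B_def)
  have "fairness \<delta> u \<le> B powr (1 / \<alpha>) - 1" if \<alpha>: "0 < \<alpha>" and fp: "fixed_point P \<delta> \<alpha> u" for \<alpha> u
  proof -
    let ?t = "trunc \<delta> u"
    have pos: "0 < ?t i" and ge: "\<delta> \<le> ?t i" for i
      using assms(2) by (auto simp: trunc_def)
    obtain a where a: "?t j \<le> ?t a" for j
    proof -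
      have "Max (range ?t) \<in> range ?t" by (rule Max_in) auto
      then obtain a where "Max (range ?t) = ?t a" by blast
      moreover have "?t j \<le> Max (range ?t)" for j by (rule Max_ge) auto
      ultimately show thesis using that[of a] by simp
    qed
    obtain k where k: "?t k \<le> ?t j" for j
    proof -
      have "Min (range ?t) \<in> range ?t" by (rule Min_in) auto
      then obtain k where "Min (range ?t) = ?t k" by blast
      moreover have "Min (range ?t) \<le> ?t j" for j by (rule Min_le) auto
      ultimately show thesis using that[of k] by simp
    qed
    \<comment> \<open>The ratio of the weights is bounded; otherwise $a$ would never be chosen.\<close>
    have le: "?t a powr \<alpha> \<le> B * ?t k powr \<alpha>"
    proof (rule ccontr)
      assume "\<not> ?t a powr \<alpha> \<le> B * ?t k powr \<alpha>"
      then have big: "C * ?t k powr \<alpha> < ?t a powr \<alpha>" if "C \<le> B" for C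
        using that mult_right_mono[of C B "?t k powr \<alpha>"] by (simp add: not_le)
      have ak: "k \<noteq> a" "\<delta> < ?t a"
        using big[OF B(1)] ge[of k] a[of k] ge[of a] k[of a] by (auto simp: less_le)
      obtain \<pi> where st: "stationary P \<delta> \<alpha> u \<pi>"
        and u: "u a = measure_pmf.expectation \<pi> (\<lambda>y. U_hat P a (decision P \<delta> \<alpha> u y) y)"
        using fp by (auto simp: fixed_point_def)
      have "u a \<le> 0"
        unfolding u
      proof (rule never_chosen_utility_nonpos[OF P st], rule stationary_never_chosen[OF P st ak(1)])
        fix y assume y: "y \<in> states P"
        show "decision P \<delta> \<alpha> u y a = 0" if "fst y \<noteq> a"
          using chosen_away_ratio[OF P assms(2) y that _ g(1) g(2)[OF y that[symmetric]]] big[OF B(2)]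
          by (meson not_le)
        show "decision P \<delta> \<alpha> u y a = 0" if "0 < fst (snd y) k"
          using chosen_queue_ratio[OF P assms(2) y \<alpha> assms(3) _ that k] big[OF B(3)]
          by (meson not_le)
      qed
      then show False using ak(2) assms(2) by (simp add: trunc_def)
    qed
    have "?t a / ?t k = ((?t a / ?t k) powr \<alpha>) powr (1 / \<alpha>)"
      using pos[of a] pos[of k] \<alpha> by (simp add: powr_powr)
    also have "\<dots> \<le> B powr (1 / \<alpha>)"
      using le pos[of a] pos[of k] \<alpha> by (intro powr_mono2) (auto simp: powr_divide divide_le_eq)
    finally have "?t a / ?t k \<le> B powr (1 / \<alpha>)" .
    moreover have "?t i / ?t j \<le> ?t a / ?t k" for i j
      using a[of i] k[of j] pos[of i] pos[of k] by (intro frac_le) linarith+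
    ultimately have "?t i / ?t j \<le> B powr (1 / \<alpha>)" for i j
      using order_trans by blast
    then show ?thesis
      unfolding fairness_def by (auto simp: Max_le_iff)
  qed
  then show ?thesis using B(1) by blast
qed

end
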